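(* Let $S$ be a nonempty commutative semigroup, let $\phi:G\to H$ be a homomorphism (or antihomomorphism) of groups, and let $f:S\to G$ be a polynomial map of degree $d$. Then the induced function $f_*=\phi\circ f:S\to H$ is a polynomial map of degree $\le d$. In particular, if $\phi:G\to H$ is an isomorphism (or antiisomorphism) of groups, then a map $f:S\to G$ is a polynomial map of degree $d$ if and only if $f_*=\phi\circ f$ is.
   Context: An antihomomorphism of groups $\phi:G\to H$ is a map with $\phi(xy)=\phi(y)\phi(x)$ for all $x,y\in G$; an antiisomorphism is a bijective antihomomorphism. Let $S$ be a nonempty commutative semigroup (written additively) and $G$ a group with identity $1_G$. A map $f:S\to G$ is a polynomial map of degree $-\infty$ if $f(s)=1_G$ for all $s$, and of degree $0$ if it is constant with value different from $1_G$. Thus degree $\le 0$ means constant. Inductively, for $d\in\{0,1,2,\dots\}$, $f$ is a polynomial map of degree $\le d+1$ if for every $s\in S$ both maps $L_s(f):t\mapsto f(s+t)f(t)^{-1}$ and $R_s(f):t\mapsto f(t)^{-1}f(s+t)$ from $S$ to $G$ are polynomial maps of degree $\le d$. The degree of a polynomial map is the least such $d\in\{-\infty,0,1,2,\dots\}$. A map is a polynomial map if it is a polynomial map of degree $\le d$ for some $d$. *)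

theory Defs
  imports "HOL-Algebra.Group" "HOL-Library.Option_ord"
begin

text \<open>
  Degrees live in \<open>{-\<infinity>, 0, 1, 2, \<dots>}\<close>, encoded as \<open>nat option\<close> with \<open>None\<close> for \<open>-\<infinity>\<close>;
  the order from \<open>HOL-Library.Option_ord\<close> makes \<open>None\<close> the bottom element.
  Commutative semigroups are types of class \<open>ab_semigroup_add\<close> (types are nonempty), while groups
  are those of HOL-Algebra, so a map from the semigroup to \<open>G\<close> is an element of
  \<open>UNIV \<rightarrow> carrier G\<close>.
\<close>

definition left_diff ::
    "('g, 'm) monoid_scheme \<Rightarrow> 's::ab_semigroup_add \<Rightarrow> ('s \<Rightarrow> 'g) \<Rightarrow> 's \<Rightarrow> 'g" where
  "left_diff G s f = (\<lambda>t. f (s + t) \<otimes>\<^bsub>G\<^esub> inv\<^bsub>G\<^esub> (f t))"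

definition right_diff ::
    "('g, 'm) monoid_scheme \<Rightarrow> 's::ab_semigroup_add \<Rightarrow> ('s \<Rightarrow> 'g) \<Rightarrow> 's \<Rightarrow> 'g" where
  "right_diff G s f = (\<lambda>t. inv\<^bsub>G\<^esub> (f t) \<otimes>\<^bsub>G\<^esub> f (s + t))"

fun poly_map_le ::
    "('g, 'm) monoid_scheme \<Rightarrow> nat option \<Rightarrow> ('s::ab_semigroup_add \<Rightarrow> 'g) \<Rightarrow> bool" where
  "poly_map_le G None f \<longleftrightarrow> (\<forall>s. f s = \<one>\<^bsub>G\<^esub>)"
| "poly_map_le G (Some 0) f \<longleftrightarrow> (\<exists>c\<in>carrier G. \<forall>s. f s = c)"
| "poly_map_le G (Some (Suc d)) f \<longleftrightarrow> f \<in> UNIV \<rightarrow> carrier G \<and>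
     (\<forall>s. poly_map_le G (Some d) (left_diff G s f) \<and> poly_map_le G (Some d) (right_diff G s f))"

definition poly_map :: "('g, 'm) monoid_scheme \<Rightarrow> ('s::ab_semigroup_add \<Rightarrow> 'g) \<Rightarrow> bool" where
  "poly_map G f \<longleftrightarrow> (\<exists>d. poly_map_le G d f)"

text \<open>Only meaningful for polynomial maps.\<close>

definition poly_map_degree ::
    "('g, 'm) monoid_scheme \<Rightarrow> ('s::ab_semigroup_add \<Rightarrow> 'g) \<Rightarrow> nat option" where
  "poly_map_degree G f = (LEAST d. poly_map_le G d f)"

definition poly_map_of_degree ::
    "('g, 'm) monoid_scheme \<Rightarrow> nat option \<Rightarrow> ('s::ab_semigroup_add \<Rightarrow> 'g) \<Rightarrow> bool" where
  "poly_map_of_degree G d f \<longleftrightarrow> poly_map G f \<and> poly_map_degree G f = d"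

lemma poly_map_of_degree_iff:
  "poly_map_of_degree G d f \<longleftrightarrow> poly_map_le G d f \<and> (\<forall>e<d. \<not> poly_map_le G e f)"
  unfolding poly_map_of_degree_def poly_map_degree_def poly_map_def
  by (metis LeastI Least_le not_less not_less_Least order.antisym)

lemma poly_map_of_degree_None_iff:
  "poly_map_of_degree G None f \<longleftrightarrow> (\<forall>s. f s = \<one>\<^bsub>G\<^esub>)"
  by (simp add: poly_map_of_degree_iff)

lemma poly_map_of_degree_0_iff:
  "poly_map_of_degree G (Some 0) f \<longleftrightarrow> (\<exists>c\<in>carrier G. c \<noteq> \<one>\<^bsub>G\<^esub> \<and> (\<forall>s. f s = c))"
proof -
  have "e < Some 0 \<longleftrightarrow> e = None" for e :: "nat option"
    by (cases e) auto
  then show ?thesis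
    by (auto simp: poly_map_of_degree_iff)
qed

definition antihom ::
    "('g, 'm) monoid_scheme \<Rightarrow> ('h, 'n) monoid_scheme \<Rightarrow> ('g \<Rightarrow> 'h) set" where
  "antihom G H = {\<phi> \<in> carrier G \<rightarrow> carrier H.
     \<forall>x\<in>carrier G. \<forall>y\<in>carrier G. \<phi> (x \<otimes>\<^bsub>G\<^esub> y) = \<phi> y \<otimes>\<^bsub>H\<^esub> \<phi> x}"

definition antiiso ::
    "('g, 'm) monoid_scheme \<Rightarrow> ('h, 'n) monoid_scheme \<Rightarrow> ('g \<Rightarrow> 'h) set" where
  "antiiso G H = {\<phi> \<in> antihom G H. bij_betw \<phi> (carrier G) (carrier H)}"

end

theory Submission imports Defs begin

text \<open>
  A homomorphism commutes with products and inverses, hence with both difference operators: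
  \<open>L_s (\<phi> \<circ> f) = \<phi> \<circ> L_s f\<close> and \<open>R_s (\<phi> \<circ> f) = \<phi> \<circ> R_s f\<close>. Induction on the degree bound then
  shows that \<open>\<phi> \<circ> f\<close> satisfies every degree bound that \<open>f\<close> does (\<open>poly_map_le_hom\<close>). For an
  isomorphism the inverse transports bounds back, so \<open>f\<close> and \<open>\<phi> \<circ> f\<close> satisfy the same bounds
  and have the same degree.

  Antihomomorphisms need no separate induction. They are the homomorphisms into the opposite
  group, and passing to the opposite group merely exchanges \<open>L_s\<close> and \<open>R_s\<close>. Since the notion of
  a polynomial map is symmetric in these two operators, a map satisfies the same degree bounds
  with values in a group as with values in its opposite (\<open>poly_map_le_opposite\<close>).
\<close>

definition opposite :: "('h, 'n) monoid_scheme \<Rightarrow> ('h, 'n) monoid_scheme" where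
  "opposite H = H\<lparr>mult := \<lambda>x y. y \<otimes>\<^bsub>H\<^esub> x\<rparr>"

lemma carrier_opposite [simp]: "carrier (opposite H) = carrier H"
  and one_opposite [simp]: "\<one>\<^bsub>opposite H\<^esub> = \<one>\<^bsub>H\<^esub>"
  and mult_opposite [simp]: "x \<otimes>\<^bsub>opposite H\<^esub> y = y \<otimes>\<^bsub>H\<^esub> x"
  by (simp_all add: opposite_def)

text \<open>An inverse is by definition two-sided, and reversing the product only swaps the two defining
  equations, so the inverse is the same even where the structure is no group.\<close>

lemma inv_opposite [simp]: "inv\<^bsub>opposite H\<^esub> x = inv\<^bsub>H\<^esub> x"
  by (simp add: m_inv_def conj_commute)

lemma group_opposite:
  assumes "group H"
  shows "group (opposite H)"
proof -
  interpret group H by fact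
  show ?thesis
    by (rule groupI) (auto simp: m_assoc intro: r_inv)
qed

lemma antihom_eq_hom_opposite: "antihom G H = hom G (opposite H)"
  by (simp add: antihom_def hom_def)

lemma antiiso_eq_iso_opposite: "antiiso G H = iso G (opposite H)"
  by (simp add: antiiso_def iso_def antihom_eq_hom_opposite)

lemma left_diff_opposite: "left_diff (opposite H) s f = right_diff H s f"
  and right_diff_opposite: "right_diff (opposite H) s f = left_diff H s f"
  by (simp_all add: left_diff_def right_diff_def)

text \<open>The recursion requires the same bound of \<open>L_s f\<close> as of \<open>R_s f\<close> for every \<open>s\<close>, so exchanging
  the two operators at each step of the induction leaves it unchanged.\<close>

lemma poly_map_le_opposite: "poly_map_le (opposite H) d f \<longleftrightarrow> poly_map_le H d f"
proof (cases d)
  case (Some n)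
  have "poly_map_le (opposite H) (Some n) f \<longleftrightarrow> poly_map_le H (Some n) f"
    by (induction n arbitrary: f) (auto simp: left_diff_opposite right_diff_opposite)
  then show ?thesis by (simp add: Some)
qed simp

lemma (in group) diff_closed:
  assumes "f \<in> UNIV \<rightarrow> carrier G"
  shows "left_diff G s f \<in> UNIV \<rightarrow> carrier G" "right_diff G s f \<in> UNIV \<rightarrow> carrier G"
  using assms by (auto simp: left_diff_def right_diff_def Pi_iff)

context group_hom
begin

lemma diff_comp_hom:
  assumes "f \<in> UNIV \<rightarrow> carrier G"
  shows "left_diff H s (h \<circ> f) = h \<circ> left_diff G s f"
    and "right_diff H s (h \<circ> f) = h \<circ> right_diff G s f"
  using assms by (auto simp: left_diff_def right_diff_def Pi_iff fun_eq_iff)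

text \<open>The induction must range over all maps into \<open>G\<close>, since the hypothesis is applied to the
  differences of \<open>f\<close>. The base cases say that \<open>h\<close> preserves the identity and sends constant maps
  to constant maps.\<close>

lemma poly_map_le_hom:
  assumes "f \<in> UNIV \<rightarrow> carrier G" and "poly_map_le G d f"
  shows "poly_map_le H d (h \<circ> f)"
proof (cases d)
  case None
  with assms show ?thesis by simp
next
  case (Some n)
  have "poly_map_le G (Some n) f \<Longrightarrow> poly_map_le H (Some n) (h \<circ> f)"
    using assms(1)
  proof (induction n arbitrary: f)
    case 0
    then show ?case by auto
  next
    case (Suc n)
    have "h \<circ> f \<in> UNIV \<rightarrow> carrier H"
      using Suc.prems(2) by (simp add: Pi_iff)
    with Suc show ?case
      using G.diff_closed[of f] by (auto simp: diff_comp_hom simp del: comp_apply)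
  qed
  with assms(2) Some show ?thesis by simp
qed

end

text \<open>Both directions are instances of \<open>poly_map_le_hom\<close>: the inverse isomorphism \<open>\<psi>\<close> recovers
  \<open>f\<close> as \<open>\<psi> \<circ> (\<phi> \<circ> f)\<close>.\<close>

lemma poly_map_le_iso_iff:
  assumes "group G" and "group H" and \<phi>: "\<phi> \<in> iso G H" and f: "f \<in> UNIV \<rightarrow> carrier G"
  shows "poly_map_le H d (\<phi> \<circ> f) \<longleftrightarrow> poly_map_le G d f"
proof
  define \<psi> where "\<psi> = inv_into (carrier G) \<phi>"
  have "\<psi> \<in> iso H G"
    using group.iso_set_sym[OF \<open>group G\<close> \<phi>] by (simp add: \<psi>_def)
  then interpret \<psi>: group_hom H G \<psi>
    using assms by (simp add: group_hom_def group_hom_axioms_def iso_def)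
  have "\<psi> \<circ> (\<phi> \<circ> f) = f"
    using \<phi> f by (auto simp: \<psi>_def iso_def bij_betw_def Pi_iff)
  moreover have "\<phi> \<circ> f \<in> UNIV \<rightarrow> carrier H"
    using \<phi> f by (auto simp: iso_def hom_def)
  moreover assume "poly_map_le H d (\<phi> \<circ> f)"
  ultimately show "poly_map_le G d f"
    using \<psi>.poly_map_le_hom[of "\<phi> \<circ> f" d] by simp
next
  interpret group_hom G H \<phi>
    using assms by (simp add: group_hom_def group_hom_axioms_def iso_def)
  assume "poly_map_le G d f"
  with f show "poly_map_le H d (\<phi> \<circ> f)" by (rule poly_map_le_hom)
qed

theorem proposition4:
  fixes G :: "('g, 'm) monoid_scheme" and H :: "('h, 'n) monoid_scheme"
    and \<phi> :: "'g \<Rightarrow> 'h" and f :: "'s::ab_semigroup_add \<Rightarrow> 'g" and d :: "nat option"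
  assumes "group G" and "group H" and "f \<in> UNIV \<rightarrow> carrier G"
  shows "(\<phi> \<in> hom G H \<or> \<phi> \<in> antihom G H \<longrightarrow>
            poly_map_of_degree G d f \<longrightarrow> poly_map_le H d (\<phi> \<circ> f)) \<and>
         (\<phi> \<in> iso G H \<or> \<phi> \<in> antiiso G H \<longrightarrow>
            (poly_map_of_degree G d f \<longleftrightarrow> poly_map_of_degree H d (\<phi> \<circ> f)))"
proof -
  have hom: "poly_map_le K d (\<phi> \<circ> f)"
    if "group K" "\<phi> \<in> hom G K" "poly_map_le G d f" for K :: "('h, 'n) monoid_scheme"
    using group_hom.poly_map_le_hom[of G K \<phi> f d] that assms
    by (simp add: group_hom_def group_hom_axioms_def)
  have le: "poly_map_le H d (\<phi> \<circ> f)"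
    if "\<phi> \<in> hom G H \<or> \<phi> \<in> antihom G H" "poly_map_le G d f"
    using that hom[OF \<open>group H\<close>] hom[OF group_opposite[OF \<open>group H\<close>]]
    by (auto simp: antihom_eq_hom_opposite poly_map_le_opposite)
  have le_iff: "poly_map_le H e (\<phi> \<circ> f) \<longleftrightarrow> poly_map_le G e f"
    if "\<phi> \<in> iso G H \<or> \<phi> \<in> antiiso G H" for e
    using that poly_map_le_iso_iff[OF \<open>group G\<close> \<open>group H\<close> _ assms(3)]
      poly_map_le_iso_iff[OF \<open>group G\<close> group_opposite[OF \<open>group H\<close>] _ assms(3)]
    by (auto simp: antiiso_eq_iso_opposite poly_map_le_opposite)
  show ?thesis
    using le le_iff by (auto simp: poly_map_of_degree_iff)
qed

end
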